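(* Let $I\subset[0,\infty)$ be an interval, let $[\alpha,\beta]\subset I$ with $\alpha<\beta$, and let $G:[\alpha,\beta]\to\mathbb{R}$ be a twice differentiable function on $[\alpha,\beta]$ (derivatives at the endpoints $\alpha,\beta$ being one-sided). Let $q\geq 1$ and $\eta:\mathbb{R}\times\mathbb{R}\to\mathbb{R}$. Suppose that $|G''|^q$ is $\eta$-quasiconvex on $[\alpha,\beta]$ and that $\eta$ is bounded from above on $|G''|^q([\alpha,\beta])\times|G''|^q([\alpha,\beta])$. Then for every $\lambda\in[0,1]$, $$\left|\frac{1}{\beta-\alpha}\int_\alpha^\beta G(x)\,dx-(1-\lambda)G\left(\frac{\alpha+\beta}{2}\right)-\lambda\frac{G(\alpha)+G(\beta)}{2}\right|\leq\begin{cases}\dfrac{(\beta-\alpha)^2}{8}\left(\dfrac{8\lambda^3-3\lambda+1}{3}\right)\mathcal{U}_{q,\eta}^{1/q}, & \text{if } 0\leq\lambda\leq\frac12,\\[2mm] \dfrac{(\beta-\alpha)^2}{8}\left(\dfrac{3\lambda-1}{3}\right)\mathcal{U}_{q,\eta}^{1/q}, & \text{if } \frac12\leq\lambda\leq1,\end{cases}$$ where $$\mathcal{U}_{q,\eta}:=\max\left\{|G''(\beta)|^q,\ |G''(\beta)|^q+\eta\left(|G''(\alpha)|^q,|G''(\beta)|^q\right)\right\}.$$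
   Context: Given $\eta:\mathbb{R}\times\mathbb{R}\to\mathbb{R}$ and an interval $J\subset\mathbb{R}$, a function $F:J\to\mathbb{R}$ is called $\eta$-quasiconvex (with respect to $\eta$) on $J$ if $F(xu+(1-x)v)\leq\max\{F(v),\,F(v)+\eta(F(u),F(v))\}$ for all $u,v\in J$ and $x\in[0,1]$. *)

theory Defs
  imports "HOL-Analysis.Analysis"
begin

definition eta_quasiconvex_on :: "real set \<Rightarrow> (real \<times> real \<Rightarrow> real) \<Rightarrow> (real \<Rightarrow> real) \<Rightarrow> bool"
  where "eta_quasiconvex_on J \<eta> F \<longleftrightarrow> is_interval J \<and>
    (\<forall>u\<in>J. \<forall>v\<in>J. \<forall>x\<in>{0..1}.
       F (x * u + (1 - x) * v) \<le> max (F v) (F v + \<eta> (F u, F v)))"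

text \<open>
  In the next definition \<open>D\<close> stands for the second derivative. The base \<open>\<bar>D \<beta>\<bar>\<close> may be \<open>0\<close>,
  where \<open>0 powr q = 0\<close> is the intended value for \<open>q \<ge> 1\<close>.
\<close>

definition U_max :: "real \<Rightarrow> (real \<times> real \<Rightarrow> real) \<Rightarrow> (real \<Rightarrow> real) \<Rightarrow> real \<Rightarrow> real \<Rightarrow> real"
  where "U_max q \<eta> D \<alpha> \<beta> =
    max (\<bar>D \<beta>\<bar> powr q) (\<bar>D \<beta>\<bar> powr q + \<eta> (\<bar>D \<alpha>\<bar> powr q, \<bar>D \<beta>\<bar> powr q))"

end

theory Submission
  imports Defs
begin

text \<open>
  Every point of \<open>[\<alpha>, \<beta>]\<close> is a convex combination of \<open>\<alpha>\<close> and \<open>\<beta>\<close>, so quasiconvexity with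
  \<open>u = \<alpha>\<close> and \<open>v = \<beta>\<close> bounds \<open>\<bar>G''\<bar>\<close> on the whole interval by the constant
  \<open>M = U_max q \<eta> G'' \<alpha> \<beta> powr (1 / q)\<close> (lemma \<open>eta_quasiconvex_imp_bounded\<close>). What remains is an
  error estimate for a quadrature rule, between the midpoint and the trapezoidal rule, under
  a bound on the second derivative.

  Put \<open>h = \<beta> - \<alpha>\<close>. The rule is symmetric about the midpoint, so it may be folded there:
  it depends only on \<open>\<phi> s = G (\<alpha> + s) + G (\<beta> - s)\<close> for \<open>0 \<le> s \<le> h / 2\<close>, which satisfies
  \<open>\<phi>' (h / 2) = 0\<close> and \<open>\<bar>\<phi>''\<bar> \<le> 2 M\<close>. Integrating the product of \<open>\<phi>''\<close> with the kernel
  \<open>s (s - \<lambda> h) / 2\<close> by parts twice gives \<open>h\<close> times the error exactly: the kernel vanishes at \<open>0\<close>,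
  \<open>\<phi>'\<close> vanishes at \<open>h / 2\<close>, and the slopes of the kernel at the two ends produce the weights
  of the rule. The error is hence at most \<open>M / h\<close> times the integral of \<open>s \<bar>s - \<lambda> h\<bar>\<close> over
  \<open>[0, h / 2]\<close>. The two cases of the theorem arise because the kernel changes sign inside this
  interval exactly when \<open>0 < \<lambda> < 1/2\<close>.
\<close>

lemma eta_quasiconvex_imp_bounded:
  assumes "eta_quasiconvex_on {a..b} \<eta> (\<lambda>x. \<bar>D x\<bar> powr q)" and "a < b" and "0 < q"
    and t: "t \<in> {a..b}"
  shows "\<bar>D t\<bar> \<le> U_max q \<eta> D a b powr (1 / q)"
proof -
  define x where "x = (b - t) / (b - a)"
  have x: "x \<in> {0..1}"
    using t \<open>a < b\<close> by (simp add: x_def divide_simps)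
  have "x * (b - a) = b - t"
    using \<open>a < b\<close> by (simp add: x_def)
  then have "x * a + (1 - x) * b = t"
    by (simp add: algebra_simps)
  moreover have "\<bar>D (x * a + (1 - x) * b)\<bar> powr q \<le> U_max q \<eta> D a b"
    using assms(1) x \<open>a < b\<close> unfolding eta_quasiconvex_on_def U_max_def by auto
  ultimately have "\<bar>D t\<bar> powr q \<le> U_max q \<eta> D a b"
    by simp
  then have "(\<bar>D t\<bar> powr q) powr (1 / q) \<le> U_max q \<eta> D a b powr (1 / q)"
    using \<open>0 < q\<close> by (intro powr_mono2) auto
  then show ?thesis
    using \<open>0 < q\<close> by (simp add: powr_powr)
qed

lemma has_integral_abs_kernel_ge:
  fixes r \<mu> :: real
  assumes "0 \<le> r" "r \<le> \<mu>"
  shows "((\<lambda>s. s * \<bar>s - \<mu>\<bar>) has_integral (\<mu> * r\<^sup>2 / 2 - r ^ 3 / 3)) {0..r}"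
proof -
  have "((\<lambda>s. s * (\<mu> - s)) has_integral
      ((\<mu> * r\<^sup>2 / 2 - r ^ 3 / 3) - (\<mu> * 0\<^sup>2 / 2 - 0 ^ 3 / 3))) {0..r}"
    using assms(1)
    by (intro fundamental_theorem_of_calculus)
      (auto intro!: derivative_eq_intros
        simp: has_real_derivative_iff_has_vector_derivative[symmetric]
          algebra_simps power2_eq_square)
  then show ?thesis
    using assms by (auto intro: has_integral_eq_rhs elim!: has_integral_eq[rotated])
qed

text \<open>
  The sign of \<open>s - \<mu>\<close> changes at \<open>\<mu>\<close>; up to there the integral is the case \<open>r = \<mu>\<close> above.
\<close>

lemma has_integral_abs_kernel_le:
  fixes r \<mu> :: real
  assumes "0 \<le> \<mu>" "\<mu> \<le> r"
  shows "((\<lambda>s. s * \<bar>s - \<mu>\<bar>) has_integral (\<mu> ^ 3 / 3 + r ^ 3 / 3 - \<mu> * r\<^sup>2 / 2)) {0..r}"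
proof -
  have "((\<lambda>s. s * (s - \<mu>)) has_integral
      ((r ^ 3 / 3 - \<mu> * r\<^sup>2 / 2) - (\<mu> ^ 3 / 3 - \<mu> * \<mu>\<^sup>2 / 2))) {\<mu>..r}"
    using assms(2)
    by (intro fundamental_theorem_of_calculus)
      (auto intro!: derivative_eq_intros
        simp: has_real_derivative_iff_has_vector_derivative[symmetric]
          algebra_simps power2_eq_square)
  then have "((\<lambda>s. s * \<bar>s - \<mu>\<bar>) has_integral
      ((r ^ 3 / 3 - \<mu> * r\<^sup>2 / 2) - (\<mu> ^ 3 / 3 - \<mu> * \<mu>\<^sup>2 / 2))) {\<mu>..r}"
    by (auto elim!: has_integral_eq[rotated])
  from has_integral_combine[OF assms has_integral_abs_kernel_ge[OF assms(1) order_refl] this]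
  show ?thesis
    by (rule has_integral_eq_rhs) (simp add: power3_eq_cube power2_eq_square)
qed

text \<open>
  This is the double integration by parts against the kernel \<open>k s = s (s - \<mu>) / 2\<close>. Since
  \<open>k'' = 1\<close>, the product rule makes \<open>k \<phi>'' - \<phi>\<close> the derivative of \<open>k \<phi>' - k' \<phi>\<close>. No continuity
  of \<open>\<phi>''\<close> is available, but the fundamental theorem of calculus for the Henstock-Kurzweil
  integral applies to every derivative, so the integrability of \<open>k \<phi>''\<close> is a conclusion here.
\<close>

lemma kernel_error_bound:
  fixes \<phi> \<phi>' \<phi>'' :: "real \<Rightarrow> real"
  assumes "0 \<le> r"
    and d1: "\<And>s. s \<in> {0..r} \<Longrightarrow> (\<phi> has_real_derivative \<phi>' s) (at s within {0..r})"
    and d2: "\<And>s. s \<in> {0..r} \<Longrightarrow> (\<phi>' has_real_derivative \<phi>'' s) (at s within {0..r})"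
    and bound: "\<And>s. s \<in> {0..r} \<Longrightarrow> \<bar>\<phi>'' s\<bar> \<le> 2 * M"
    and "\<phi>' r = 0"
    and int: "(\<phi> has_integral A) {0..r}"
    and kernel: "((\<lambda>s. s * \<bar>s - \<mu>\<bar>) has_integral K) {0..r}"
  shows "\<bar>A - (r - \<mu> / 2) * \<phi> r - \<mu> / 2 * \<phi> 0\<bar> \<le> M * K"
proof -
  define P where "P = (\<lambda>s. s * (s - \<mu>) / 2 * \<phi>' s - (s - \<mu> / 2) * \<phi> s)"
  have "(P has_real_derivative s * (s - \<mu>) / 2 * \<phi>'' s - \<phi> s) (at s within {0..r})"
    if "s \<in> {0..r}" for s
    unfolding P_def using d1[OF that] d2[OF that]
    by (auto intro!: derivative_eq_intros simp: field_simps)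
  then have "((\<lambda>s. s * (s - \<mu>) / 2 * \<phi>'' s - \<phi> s) has_integral (P r - P 0)) {0..r}"
    using \<open>0 \<le> r\<close>
    by (intro fundamental_theorem_of_calculus)
      (auto simp: has_real_derivative_iff_has_vector_derivative[symmetric])
  from has_integral_add[OF this int]
  have "((\<lambda>s. s * (s - \<mu>) / 2 * \<phi>'' s) has_integral (P r - P 0 + A)) {0..r}"
    by simp
  moreover have "((\<lambda>s. M * (s * \<bar>s - \<mu>\<bar>)) has_integral (M * K)) {0..r}"
    using kernel by (rule has_integral_mult_right)
  moreover have "norm (s * (s - \<mu>) / 2 * \<phi>'' s) \<le> M * (s * \<bar>s - \<mu>\<bar>)" if "s \<in> {0..r}" for s
  proof -
    have "norm (s * (s - \<mu>) / 2 * \<phi>'' s) = s * \<bar>s - \<mu>\<bar> / 2 * \<bar>\<phi>'' s\<bar>"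
      using that by (simp add: abs_mult)
    also have "\<dots> \<le> s * \<bar>s - \<mu>\<bar> / 2 * (2 * M)"
      using that bound[OF that] by (intro mult_left_mono) auto
    finally show ?thesis
      by (simp add: mult_ac)
  qed
  ultimately have "norm (P r - P 0 + A) \<le> M * K"
    by (metis (no_types, lifting) has_integral_iff integral_norm_bound_integral)
  moreover have "P r - P 0 + A = A - (r - \<mu> / 2) * \<phi> r - \<mu> / 2 * \<phi> 0"
    using \<open>\<phi>' r = 0\<close> by (simp add: P_def)
  ultimately show ?thesis
    by simp
qed

lemma has_real_derivative_fold:
  fixes f :: "real \<Rightarrow> real"
  assumes "\<And>x. x \<in> {a..b} \<Longrightarrow> (f has_real_derivative f' x) (at x within {a..b})"
    and s: "s \<in> {0..(b - a) / 2}"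
  shows "((\<lambda>s. f (a + s)) has_real_derivative f' (a + s)) (at s within {0..(b - a) / 2})"
    and "((\<lambda>s. f (b - s)) has_real_derivative - f' (b - s)) (at s within {0..(b - a) / 2})"
proof -
  have "(f has_real_derivative f' (a + s)) (at (a + s) within (\<lambda>s. a + s) ` {0..(b - a) / 2})"
    using s by (intro has_field_derivative_subset[OF assms(1)]) (auto simp: field_simps)
  from DERIV_image_chain[OF this DERIV_add[OF DERIV_const DERIV_ident]]
  show "((\<lambda>s. f (a + s)) has_real_derivative f' (a + s)) (at s within {0..(b - a) / 2})"
    by (simp add: o_def)
  have "(f has_real_derivative f' (b - s)) (at (b - s) within (\<lambda>s. b - s) ` {0..(b - a) / 2})"
    using s by (intro has_field_derivative_subset[OF assms(1)]) (auto simp: field_simps)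
  from DERIV_image_chain[OF this DERIV_diff[OF DERIV_const DERIV_ident]]
  show "((\<lambda>s. f (b - s)) has_real_derivative - f' (b - s)) (at s within {0..(b - a) / 2})"
    by (simp add: o_def)
qed

text \<open>
  With \<open>F\<close> an antiderivative of \<open>f\<close>, the function \<open>F (a + s) - F (b - s)\<close> is one of the
  folded function. It vanishes at the fold, so only \<open>F b - F a\<close> survives.
\<close>

lemma has_integral_fold:
  fixes f :: "real \<Rightarrow> real"
  assumes "a \<le> b" and "continuous_on {a..b} f"
  shows "((\<lambda>s. f (a + s) + f (b - s)) has_integral (integral {a..b} f)) {0..(b - a) / 2}"
proof -
  define F where "F = (\<lambda>x. integral {a..x} f)"
  have F: "(F has_real_derivative f x) (at x within {a..b})" if "x \<in> {a..b}" for x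
    unfolding F_def using assms(2) that by (rule integral_has_real_derivative)
  have "((\<lambda>s. F (a + s) - F (b - s)) has_real_derivative f (a + s) + f (b - s))
      (at s within {0..(b - a) / 2})" if "s \<in> {0..(b - a) / 2}" for s
    using DERIV_diff[OF has_real_derivative_fold[of a b F f s, OF F that]] by simp
  then have "((\<lambda>s. f (a + s) + f (b - s)) has_integral
      ((F (a + (b - a) / 2) - F (b - (b - a) / 2)) - (F (a + 0) - F (b - 0)))) {0..(b - a) / 2}"
    using \<open>a \<le> b\<close>
    by (intro fundamental_theorem_of_calculus[where f = "\<lambda>s. F (a + s) - F (b - s)"])
      (auto simp: has_real_derivative_iff_has_vector_derivative[symmetric])
  moreover have "a + (b - a) / 2 = b - (b - a) / 2"
    by (simp add: field_simps)
  ultimately show ?thesis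
    by (simp add: F_def)
qed

text \<open>
  The kernel integral scales with the cube of the length of the interval. Writing it as
  \<open>(b - a) ^ 3 * C\<close> makes \<open>C\<close> depend on \<open>lam\<close> only, and leaves open on which side of the
  midpoint the sign change \<open>lam * (b - a)\<close> of the kernel lies.
\<close>

lemma quadrature_error_bound:
  fixes G G' G'' :: "real \<Rightarrow> real"
  assumes "a < b"
    and d1: "\<And>x. x \<in> {a..b} \<Longrightarrow> (G has_real_derivative G' x) (at x within {a..b})"
    and d2: "\<And>x. x \<in> {a..b} \<Longrightarrow> (G' has_real_derivative G'' x) (at x within {a..b})"
    and bound: "\<And>x. x \<in> {a..b} \<Longrightarrow> \<bar>G'' x\<bar> \<le> M"
    and kernel: "((\<lambda>s. s * \<bar>s - lam * (b - a)\<bar>) has_integral ((b - a) ^ 3 * C)) {0..(b - a) / 2}"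
  shows "\<bar>1 / (b - a) * integral {a..b} G - (1 - lam) * G ((a + b) / 2) - lam * ((G a + G b) / 2)\<bar>
    \<le> (b - a)\<^sup>2 * C * M"
proof -
  define h where "h = b - a"
  have h: "0 < h"
    using \<open>a < b\<close> by (simp add: h_def)
  define \<phi> where "\<phi> = (\<lambda>s. G (a + s) + G (b - s))"
  define \<phi>' where "\<phi>' = (\<lambda>s. G' (a + s) - G' (b - s))"
  define \<phi>'' where "\<phi>'' = (\<lambda>s. G'' (a + s) + G'' (b - s))"
  have mid: "a + h / 2 = (a + b) / 2" "b - h / 2 = (a + b) / 2"
    by (simp_all add: h_def field_simps)
  have "(\<phi> has_real_derivative \<phi>' s) (at s within {0..h / 2})" if "s \<in> {0..h / 2}" for s
    using DERIV_add[OF has_real_derivative_fold[of a b G G' s, OF d1 that[unfolded h_def]]]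
    by (simp add: \<phi>_def \<phi>'_def h_def)
  moreover have "(\<phi>' has_real_derivative \<phi>'' s) (at s within {0..h / 2})"
    if "s \<in> {0..h / 2}" for s
    using DERIV_diff[OF has_real_derivative_fold[of a b G' G'' s, OF d2 that[unfolded h_def]]]
    by (simp add: \<phi>'_def \<phi>''_def h_def)
  moreover have "\<bar>\<phi>'' s\<bar> \<le> 2 * M" if "s \<in> {0..h / 2}" for s
  proof -
    have "a + s \<in> {a..b}" "b - s \<in> {a..b}"
      using that by (auto simp: h_def field_simps)
    from this[THEN bound] show ?thesis
      by (simp add: \<phi>''_def)
  qed
  moreover have "\<phi>' (h / 2) = 0"
    by (simp add: \<phi>'_def mid)
  moreover have "(\<phi> has_integral (integral {a..b} G)) {0..h / 2}"
    unfolding \<phi>_def h_def using \<open>a < b\<close> d1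
    by (intro has_integral_fold DERIV_continuous_on) auto
  moreover have "((\<lambda>s. s * \<bar>s - lam * h\<bar>) has_integral (h ^ 3 * C)) {0..h / 2}"
    using kernel by (simp add: h_def)
  ultimately have "\<bar>integral {a..b} G - (h / 2 - lam * h / 2) * \<phi> (h / 2) - lam * h / 2 * \<phi> 0\<bar>
      \<le> M * (h ^ 3 * C)"
    using h by (intro kernel_error_bound[where \<phi>' = \<phi>' and \<phi>'' = \<phi>'']) auto
  also have "integral {a..b} G - (h / 2 - lam * h / 2) * \<phi> (h / 2) - lam * h / 2 * \<phi> 0
      = h * (1 / h * integral {a..b} G - (1 - lam) * G ((a + b) / 2) - lam * ((G a + G b) / 2))"
    using h by (simp add: \<phi>_def mid field_simps)
  also have "M * (h ^ 3 * C) = h * (h\<^sup>2 * C * M)"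
    by (simp add: power3_eq_cube power2_eq_square)
  finally show ?thesis
    using h by (simp add: abs_mult h_def)
qed

theorem theorem10:
  fixes I :: "real set" and \<alpha> \<beta> q :: real
    and G G' G'' :: "real \<Rightarrow> real"
    and \<eta> :: "real \<times> real \<Rightarrow> real"
  assumes "is_interval I" and "I \<subseteq> {0..}"
    and "{\<alpha>..\<beta>} \<subseteq> I" and "\<alpha> < \<beta>"
    and "\<And>x. x \<in> {\<alpha>..\<beta>} \<Longrightarrow> (G has_real_derivative G' x) (at x within {\<alpha>..\<beta>})"
    and "\<And>x. x \<in> {\<alpha>..\<beta>} \<Longrightarrow> (G' has_real_derivative G'' x) (at x within {\<alpha>..\<beta>})"
    and "q \<ge> 1"
    and "eta_quasiconvex_on {\<alpha>..\<beta>} \<eta> (\<lambda>x. \<bar>G'' x\<bar> powr q)"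
    and "bdd_above (\<eta> ` (((\<lambda>x. \<bar>G'' x\<bar> powr q) ` {\<alpha>..\<beta>}) \<times> ((\<lambda>x. \<bar>G'' x\<bar> powr q) ` {\<alpha>..\<beta>})))"
  shows "\<forall>lam\<in>{0..1}.
      (0 \<le> lam \<and> lam \<le> 1 / 2 \<longrightarrow>
        \<bar>1 / (\<beta> - \<alpha>) * integral {\<alpha>..\<beta>} G - (1 - lam) * G ((\<alpha> + \<beta>) / 2) - lam * ((G \<alpha> + G \<beta>) / 2)\<bar>
          \<le> (\<beta> - \<alpha>)\<^sup>2 / 8 * ((8 * lam ^ 3 - 3 * lam + 1) / 3) * U_max q \<eta> G'' \<alpha> \<beta> powr (1 / q)) \<and>
      (1 / 2 \<le> lam \<and> lam \<le> 1 \<longrightarrow>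
        \<bar>1 / (\<beta> - \<alpha>) * integral {\<alpha>..\<beta>} G - (1 - lam) * G ((\<alpha> + \<beta>) / 2) - lam * ((G \<alpha> + G \<beta>) / 2)\<bar>
          \<le> (\<beta> - \<alpha>)\<^sup>2 / 8 * ((3 * lam - 1) / 3) * U_max q \<eta> G'' \<alpha> \<beta> powr (1 / q))"
proof (intro ballI conjI impI)
  fix lam :: real
  define h where "h = \<beta> - \<alpha>"
  have h: "0 < h"
    using assms(4) by (simp add: h_def)
  have "\<bar>G'' x\<bar> \<le> U_max q \<eta> G'' \<alpha> \<beta> powr (1 / q)" if "x \<in> {\<alpha>..\<beta>}" for x
    using eta_quasiconvex_imp_bounded[OF assms(8,4) _ that] assms(7) by simp
  note error = quadrature_error_bound[where G = G, OF assms(4) assms(5) assms(6) this]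
  {
    assume lam: "0 \<le> lam \<and> lam \<le> 1 / 2"
    then have "0 \<le> lam * h" "lam * h \<le> h / 2"
      using h by (auto simp: field_simps)
    then have "((\<lambda>s. s * \<bar>s - lam * h\<bar>) has_integral
        (h ^ 3 * ((8 * lam ^ 3 - 3 * lam + 1) / 24))) {0..h / 2}"
      by (rule has_integral_eq_rhs[OF has_integral_abs_kernel_le])
        (simp add: field_simps power3_eq_cube power2_eq_square)
    from error[OF _ _ _ this[unfolded h_def]]
    show "\<bar>1 / (\<beta> - \<alpha>) * integral {\<alpha>..\<beta>} G - (1 - lam) * G ((\<alpha> + \<beta>) / 2) - lam * ((G \<alpha> + G \<beta>) / 2)\<bar>
        \<le> (\<beta> - \<alpha>)\<^sup>2 / 8 * ((8 * lam ^ 3 - 3 * lam + 1) / 3) * U_max q \<eta> G'' \<alpha> \<beta> powr (1 / q)"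
      by simp
  next
    assume lam: "1 / 2 \<le> lam \<and> lam \<le> 1"
    then have "0 \<le> h / 2" "h / 2 \<le> lam * h"
      using h by (auto simp: field_simps)
    then have "((\<lambda>s. s * \<bar>s - lam * h\<bar>) has_integral
        (h ^ 3 * ((3 * lam - 1) / 24))) {0..h / 2}"
      by (rule has_integral_eq_rhs[OF has_integral_abs_kernel_ge])
        (simp add: field_simps power3_eq_cube power2_eq_square)
    from error[OF _ _ _ this[unfolded h_def]]
    show "\<bar>1 / (\<beta> - \<alpha>) * integral {\<alpha>..\<beta>} G - (1 - lam) * G ((\<alpha> + \<beta>) / 2) - lam * ((G \<alpha> + G \<beta>) / 2)\<bar>
        \<le> (\<beta> - \<alpha>)\<^sup>2 / 8 * ((3 * lam - 1) / 3) * U_max q \<eta> G'' \<alpha> \<beta> powr (1 / q)"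
      by simp
  }
qed

end
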